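(* Let $\mathbb{k}$ be a nontrivial semiring, let $K, L$ be simplicial complexes over a type $E$, let $s \in K$ be a face and let $x \in E$ with $x \notin V(K)$. Then, as complexes over $E \times \mathbb{k}$, \[ (\sigma_s K) \star L = \sigma_{s \sqcup_s \emptyset}(K \star L), \] where $\sigma_s K$ is taken with barycenter $x$ and $\sigma_{s \sqcup_s \emptyset}(K \star L)$ is taken with barycenter $(x,0)$.
   Context: A simplicial complex over a type (set) $E$ is a set $K$ of nonempty finite subsets of $E$ (its faces) such that every nonempty subset of a face is a face. It may be empty or infinite, and not every element of $E$ need be a vertex. $V(K) = \{x \in E \mid \{x\} \in K\}$. For a finite set $s \subseteq E$: $\mathrm{Lk}(K,s) = \{t \in K \mid s \cup t \in K,\ s \cap t = \emptyset\}$; $\partial s = \{t \subseteq s \mid t \ne \emptyset,\ t \neq s\}$. For finite $s,t \subseteq E$, $s \sqcup_s t = (s \times \{0\}) \cup (t \times \{1\}) \subseteq E \times \mathbb{k}$ (the subscript in $\sqcup_s$ is part of the symbol and unrelated to the set $s$). The join $K \star L$ of complexes over $E$ is the complex over $E \times \mathbb{k}$ with faces $\{s \sqcup_s t \mid s \in K \cup \{\emptyset\},\ t \in L \cup \{\emptyset\}\} \setminus \{\emptyset\}$. For a complex $K$ over a type $E$, a face $s \in K$ and $x \in E \setminus V(K)$, the stellar subdivision $\sigma_s K$ of $K$ at $s$ with barycenter $x$ is the complex over $E$ whose faces are the faces of $K$ not containing $s$ together with all nonempty sets $a \cup b \cup c$ with $a \in \mathrm{Lk}(K,s) \cup \{\emptyset\}$,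 $b \in \partial s \cup \{\emptyset\}$, $c \in \{\emptyset, \{x\}\}$. *)

theory Defs
  imports Main
begin

text \<open>
  Abstract simplicial complexes, given by their sets of faces. The empty set is never a face,
  and \<open>K\<close> may be empty or infinite.
\<close>

definition abstract_complex :: "'a set set \<Rightarrow> bool" where
  "abstract_complex K \<longleftrightarrow>
     (\<forall>s\<in>K. finite s \<and> s \<noteq> {}) \<and> (\<forall>s\<in>K. \<forall>t. t \<subseteq> s \<and> t \<noteq> {} \<longrightarrow> t \<in> K)"

definition vertices :: "'a set set \<Rightarrow> 'a set" where
  "vertices K = {x. {x} \<in> K}"

definition link :: "'a set set \<Rightarrow> 'a set \<Rightarrow> 'a set set" where
  "link K s = {t \<in> K. s \<union> t \<in> K \<and> s \<inter> t = {}}"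

definition bdry :: "'a set \<Rightarrow> 'a set set" where
  "bdry s = {t. t \<subseteq> s \<and> t \<noteq> {} \<and> t \<noteq> s}"

text \<open>
  The class \<open>semiring_1\<close> includes \<open>0 \<noteq> 1\<close>, so it is exactly the class of nontrivial
  (not necessarily commutative) unital semirings, and the two copies below are disjoint.
\<close>

definition dunion :: "'a set \<Rightarrow> 'a set \<Rightarrow> ('a \<times> 'k::semiring_1) set"  (infixl "\<squnion>\<^sub>s" 65) where
  "s \<squnion>\<^sub>s t = (s \<times> {0}) \<union> (t \<times> {1})"

definition cjoin :: "'a set set \<Rightarrow> 'a set set \<Rightarrow> ('a \<times> 'k::semiring_1) set set"  (infixl "\<star>" 70) where
  "K \<star> L = {s \<squnion>\<^sub>s t | s t. s \<in> K \<union> {{}} \<and> t \<in> L \<union> {{}}} - {{}}"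

text \<open>
  \<open>stellar K s x\<close> is the subdivision of \<open>K\<close> at \<open>s\<close> with barycenter \<open>x\<close>; it is meaningful for
  \<open>s \<in> K\<close> and \<open>x \<notin> vertices K\<close>.
\<close>

definition stellar :: "'a set set \<Rightarrow> 'a set \<Rightarrow> 'a \<Rightarrow> 'a set set" where
  "stellar K s x =
     {t \<in> K. \<not> s \<subseteq> t} \<union>
     ({a \<union> b \<union> c | a b c. a \<in> link K s \<union> {{}} \<and> b \<in> bdry s \<union> {{}} \<and> c \<in> {{}, {x}}} - {{}})"

text \<open>
  The constructions yield complexes, and the side conditions for subdividing \<open>K\<close> at \<open>s\<close> carry
  over to the join.
\<close>

lemma abstract_complexD:
  assumes "abstract_complex K" "s \<in> K"
  shows "finite s" "s \<noteq> {}" "\<And>t. t \<subseteq> s \<Longrightarrow> t \<noteq> {} \<Longrightarrow> t \<in> K"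
  using assms unfolding abstract_complex_def by blast+

lemma abstract_complex_cjoin:
  assumes "abstract_complex K" "abstract_complex L"
  shows "abstract_complex (K \<star> L :: ('a \<times> 'k::semiring_1) set set)"
  unfolding abstract_complex_def
proof (intro conjI ballI allI impI)
  fix u :: "('a \<times> 'k) set" assume "u \<in> K \<star> L"
  then obtain s t where u: "u = s \<squnion>\<^sub>s t" "s \<in> K \<union> {{}}" "t \<in> L \<union> {{}}" "u \<noteq> {}"
    by (auto simp: cjoin_def)
  have "finite s" "finite t"
    using u(2,3) abstract_complexD(1)[OF assms(1)] abstract_complexD(1)[OF assms(2)] by auto
  then show "finite u" "u \<noteq> {}"
    using u(1,4) by (simp_all add: dunion_def)
  fix v assume v: "v \<subseteq> u \<and> v \<noteq> {}"
  define s' t' where "s' = {a. (a, 0) \<in> v}" and "t' = {a. (a, 1) \<in> v}"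
  have veq: "v = s' \<squnion>\<^sub>s t'"
    using v u(1) by (auto simp: s'_def t'_def dunion_def)
  have sub: "s' \<subseteq> s" "t' \<subseteq> t"
    using v u(1) by (auto simp: s'_def t'_def dunion_def)
  have "s' \<in> K \<union> {{}}"
  proof (cases "s' = {}")
    case False
    then have "s \<in> K" using sub(1) u(2) by auto
    then show ?thesis by (rule abstract_complexD(3)[OF assms(1) _ sub(1) False, THEN UnI1])
  qed simp
  moreover have "t' \<in> L \<union> {{}}"
  proof (cases "t' = {}")
    case False
    then have "t \<in> L" using sub(2) u(3) by auto
    then show ?thesis by (rule abstract_complexD(3)[OF assms(2) _ sub(2) False, THEN UnI1])
  qed simp
  ultimately show "v \<in> K \<star> L"
    using v veq unfolding cjoin_def by blast
qed

lemma abstract_complex_stellar: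
  assumes K: "abstract_complex K" and s: "s \<in> K"
  shows "abstract_complex (stellar K s x)"
  unfolding abstract_complex_def
proof (intro conjI ballI allI impI)
  fix u assume u: "u \<in> stellar K s x"
  have fin: "finite t" "t \<noteq> {}" if "t \<in> K" for t
    using abstract_complexD(1,2)[OF K that] .
  have sub: "v \<in> K" if "t \<in> K" "v \<subseteq> t" "v \<noteq> {}" for t v
    using abstract_complexD(3)[OF K that] .
  show "u \<noteq> {}"
    using u fin(2) by (auto simp: stellar_def)
  show "finite u"
  proof (cases "u \<in> K")
    case False
    then obtain a b c where abc: "u = a \<union> b \<union> c" "a \<in> link K s \<union> {{}}"
        "b \<in> bdry s \<union> {{}}" "c \<in> {{}, {x}}"
      using u unfolding stellar_def by blast
    have "finite a" using abc(2) fin(1) by (auto simp: link_def)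
    moreover have "b \<subseteq> s" using abc(3) by (auto simp: bdry_def)
    then have "finite b" using fin(1)[OF s] by (rule finite_subset)
    moreover have "finite c" using abc(4) by auto
    ultimately show ?thesis using abc(1) by simp
  qed (rule fin(1))
  fix v assume v: "v \<subseteq> u \<and> v \<noteq> {}"
  consider "u \<in> K" "\<not> s \<subseteq> u"
    | a b c where "u = a \<union> b \<union> c" "a \<in> link K s \<union> {{}}" "b \<in> bdry s \<union> {{}}" "c \<in> {{}, {x}}"
    using u unfolding stellar_def by blast
  then show "v \<in> stellar K s x"
  proof cases
    case 1
    then have "v \<in> K" "\<not> s \<subseteq> v" using v sub by blast+
    then show ?thesis by (simp add: stellar_def)
  next
    case 2
    have "v \<inter> a \<in> link K s \<union> {{}}"
    proof (cases "v \<inter> a = {}")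
      case False
      then have a: "a \<in> K" "s \<union> a \<in> K" "s \<inter> a = {}"
        using 2(2) by (auto simp: link_def)
      have "v \<inter> a \<in> K"
        using False by (intro sub[OF a(1)]) simp_all
      moreover have "s \<union> (v \<inter> a) \<in> K"
        using fin(2)[OF s] by (intro sub[OF a(2)]) auto
      moreover have "s \<inter> (v \<inter> a) = {}"
        using a(3) by blast
      ultimately show ?thesis by (simp add: link_def)
    qed simp
    moreover have "v \<inter> b \<in> bdry s \<union> {{}}"
      using 2(3) by (auto simp: bdry_def)
    moreover have "v \<inter> c \<in> {{}, {x}}" using 2(4) by auto
    moreover have "v = (v \<inter> a) \<union> (v \<inter> b) \<union> (v \<inter> c)" using v 2(1) by blast
    ultimately show ?thesis using v unfolding stellar_def by blast
  qed
qed

lemma dunion_empty_in_cjoin: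
  assumes "abstract_complex K" "s \<in> K"
  shows "(s \<squnion>\<^sub>s {} :: ('a \<times> 'k::semiring_1) set) \<in> K \<star> L"
proof -
  have "s \<noteq> {}" using abstract_complexD(2)[OF assms] .
  then have "(s \<squnion>\<^sub>s {} :: ('a \<times> 'k) set) \<noteq> {}" by (simp add: dunion_def)
  then show ?thesis using assms(2) unfolding cjoin_def by blast
qed

lemma barycenter_notin_vertices_cjoin:
  assumes "x \<notin> vertices K"
  shows "(x, 0 :: 'k::semiring_1) \<notin> vertices (K \<star> L)"
proof
  assume "(x, 0 :: 'k) \<in> vertices (K \<star> L)"
  then obtain s t where st: "{(x, 0 :: 'k)} = s \<squnion>\<^sub>s t" "s \<in> K \<union> {{}}"
    by (auto simp: vertices_def cjoin_def)
  have "y \<in> s \<longleftrightarrow> y = x" for y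
  proof -
    have "y \<in> s \<longleftrightarrow> (y, 0 :: 'k) \<in> s \<squnion>\<^sub>s t" by (auto simp: dunion_def)
    then show ?thesis by (auto simp: st(1)[symmetric])
  qed
  then have "s = {x}" by auto
  then show False using st(2) assms by (simp add: vertices_def)
qed

end

theory Submission
  imports Defs
begin

text \<open>
  Adding the empty face to every complex turns each construction into an unrestricted one: the
  faces of a join are all the \<open>a \<squnion>\<^sub>s t\<close>, the link of \<open>s \<squnion>\<^sub>s {}\<close> consists of all \<open>a \<squnion>\<^sub>s t\<close> with
  \<open>a\<close> in the link of \<open>s\<close>, and the boundary of \<open>s \<squnion>\<^sub>s {}\<close> lies in the first copy. Since \<open>\<squnion>\<^sub>s\<close>
  commutes with unions and reflects inclusions, a face \<open>u \<squnion>\<^sub>s t\<close> is in the subdivided join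
  exactly when \<open>u\<close> is in the subdivision and \<open>t\<close> is in the other factor.
\<close>

lemma dunion_Un: "(s \<squnion>\<^sub>s t) \<union> (s' \<squnion>\<^sub>s t') = (s \<union> s') \<squnion>\<^sub>s (t \<union> t')"
  by (auto simp: dunion_def)

text \<open>
  Stated for arbitrary types because automation would otherwise decompose the equations between
  unions elementwise.
\<close>

lemma Collect_ternary_regroup:
  assumes "\<And>a t b c. U (d a t) (e b) (g c) = d (h a b c) t"
  shows "{U a b c | a b c. a \<in> {d a t | a t. a \<in> A \<and> t \<in> T} \<and> b \<in> {e b | b. b \<in> B}
       \<and> c \<in> {g c | c. c \<in> C}}
     = {d u t | u t. u \<in> {h a b c | a b c. a \<in> A \<and> b \<in> B \<and> c \<in> C} \<and> t \<in> T}" (is "?l = ?r")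
proof (intro subset_antisym subsetI)
  fix v assume "v \<in> ?l"
  then obtain a b c t where "v = U (d a t) (e b) (g c)" "a \<in> A" "b \<in> B" "c \<in> C" "t \<in> T"
    by blast
  then show "v \<in> ?r" unfolding assms by blast
next
  fix v assume "v \<in> ?r"
  then obtain a b c t where "v = d (h a b c) t" "a \<in> A" "b \<in> B" "c \<in> C" "t \<in> T"
    by blast
  then show "v \<in> ?l" unfolding assms[symmetric] by blast
qed

text \<open>Only the sets from the link carry vertices of the second factor, so the second component
  of a union is that of its first term.\<close>

lemma Un_dunion_families:
  "{a \<union> b \<union> c | a b c. a \<in> {a \<squnion>\<^sub>s t | a t. a \<in> A \<and> t \<in> T} \<and> b \<in> {b \<squnion>\<^sub>s {} | b. b \<in> B}
       \<and> c \<in> {c \<squnion>\<^sub>s {} | c. c \<in> C}}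
     = {u \<squnion>\<^sub>s t | u t. u \<in> {a \<union> b \<union> c | a b c. a \<in> A \<and> b \<in> B \<and> c \<in> C} \<and> t \<in> T}"
  by (rule Collect_ternary_regroup) (simp add: dunion_Un)

text \<open>Since \<open>0 \<noteq> 1\<close>, a point of one copy cannot be covered by the other
  copy. This is where nontriviality of the semiring enters.\<close>

lemma dunion_subset_iff [simp]:
  "(s \<squnion>\<^sub>s t :: ('a \<times> 'k::semiring_1) set) \<subseteq> s' \<squnion>\<^sub>s t' \<longleftrightarrow> s \<subseteq> s' \<and> t \<subseteq> t'"
  by (auto simp: dunion_def)

lemma dunion_eq_iff [simp]:
  "(s \<squnion>\<^sub>s t :: ('a \<times> 'k::semiring_1) set) = s' \<squnion>\<^sub>s t' \<longleftrightarrow> s = s' \<and> t = t'"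
  unfolding set_eq_subset dunion_subset_iff by blast

lemma dunion_empty_empty [simp]: "{} \<squnion>\<^sub>s {} = {}"
  by (simp add: dunion_def)

lemma dunion_eq_empty_iff [simp]: "s \<squnion>\<^sub>s t = {} \<longleftrightarrow> s = {} \<and> t = {}"
  by (auto simp: dunion_def)

lemma dunion_Int:
  "(s \<squnion>\<^sub>s t) \<inter> (s' \<squnion>\<^sub>s t') = ((s \<inter> s') \<squnion>\<^sub>s (t \<inter> t') :: ('a \<times> 'k::semiring_1) set)"
  by (auto simp: dunion_def)

lemma subset_dunionE:
  fixes v :: "('a \<times> 'k::semiring_1) set"
  assumes "v \<subseteq> s \<squnion>\<^sub>s t"
  obtains s' t' where "v = s' \<squnion>\<^sub>s t'"
proof
  \<comment> \<open>The slices over 0 and 1 recover \<open>v\<close>, because the assumed inclusion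
    excludes points with any other second coordinate.\<close>
  show "v = {a. (a, 0) \<in> v} \<squnion>\<^sub>s {a. (a, 1) \<in> v}"
    using assms by (auto simp: dunion_def)
qed

lemma dunion_in_cjoin_iff:
  "(s \<squnion>\<^sub>s t :: ('a \<times> 'k::semiring_1) set) \<in> K \<star> L
     \<longleftrightarrow> s \<in> insert {} K \<and> t \<in> insert {} L \<and> (s \<noteq> {} \<or> t \<noteq> {})"
  by (auto simp: cjoin_def)

text \<open>Reduces an equality of families to a componentwise membership test. The first premise is
  a real restriction: the semiring may have elements besides 0 and 1.\<close>

lemma eq_dunion_familyI:
  fixes A :: "('a \<times> 'k::semiring_1) set set"
  assumes "\<And>v. v \<in> A \<Longrightarrow> \<exists>s t. v = s \<squnion>\<^sub>s t" and "\<And>s t. s \<squnion>\<^sub>s t \<in> A \<longleftrightarrow> P s t"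
  shows "A = {s \<squnion>\<^sub>s t | s t. P s t}"
proof (rule set_eqI)
  fix v
  show "v \<in> A \<longleftrightarrow> v \<in> {s \<squnion>\<^sub>s t | s t. P s t}"
  proof
    assume v: "v \<in> A"
    then obtain s t where "v = s \<squnion>\<^sub>s t" using assms(1) by blast
    moreover from this have "P s t" using v assms(2) by simp
    ultimately show "v \<in> {s \<squnion>\<^sub>s t | s t. P s t}" by blast
  next
    assume "v \<in> {s \<squnion>\<^sub>s t | s t. P s t}"
    then show "v \<in> A" using assms(2) by auto
  qed
qed

lemma empty_eq_dunion: "\<exists>s t. {} = s \<squnion>\<^sub>s t"
  using dunion_empty_empty[symmetric] by (intro exI)

lemma insert_empty_cjoin:
  "insert {} (K \<star> L :: ('a \<times> 'k::semiring_1) set set)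
     = {a \<squnion>\<^sub>s t | a t. a \<in> insert {} K \<and> t \<in> insert {} L}"
proof (rule eq_dunion_familyI)
  show "\<exists>a t. v = a \<squnion>\<^sub>s t" if "v \<in> insert {} (K \<star> L)" for v :: "('a \<times> 'k) set"
    using that empty_eq_dunion by (auto simp: cjoin_def)
qed (auto simp: dunion_in_cjoin_iff)

text \<open>Disjointness from \<open>s\<close> and the union with \<open>s\<close> are tested
  separately in each copy, and the second copy of \<open>s \<squnion>\<^sub>s {}\<close> is empty.
  For \<open>a = {}\<close> the union with \<open>s\<close> is a face because
  \<open>s \<in> K\<close>.\<close>

lemma insert_empty_link_cjoin:
  assumes "s \<in> K" "s \<noteq> {}"
  shows "insert {} (link (K \<star> L :: ('a \<times> 'k::semiring_1) set set) (s \<squnion>\<^sub>s {}))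
     = {a \<squnion>\<^sub>s t | a t. a \<in> insert {} (link K s) \<and> t \<in> insert {} L}"
proof (rule eq_dunion_familyI)
  show "\<exists>a t. v = a \<squnion>\<^sub>s t" if "v \<in> insert {} (link (K \<star> L) (s \<squnion>\<^sub>s {}))"
    for v :: "('a \<times> 'k) set"
    using that empty_eq_dunion by (auto simp: link_def cjoin_def)
  show "a \<squnion>\<^sub>s t \<in> insert {} (link (K \<star> L :: ('a \<times> 'k) set set) (s \<squnion>\<^sub>s {}))
      \<longleftrightarrow> a \<in> insert {} (link K s) \<and> t \<in> insert {} L" for a t
    using assms by (auto simp: link_def dunion_in_cjoin_iff dunion_Un dunion_Int)
qed

lemma insert_empty_bdry_dunion:
  "insert {} (bdry (s \<squnion>\<^sub>s {} :: ('a \<times> 'k::semiring_1) set))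
     = {b \<squnion>\<^sub>s {} | b. b \<in> insert {} (bdry s)}"
proof -
  \<comment> \<open>The condition \<open>t = {}\<close> brings the family into the two-parameter
    form of \<open>eq_dunion_familyI\<close>.\<close>
  have "insert {} (bdry (s \<squnion>\<^sub>s {} :: ('a \<times> 'k) set))
      = {b \<squnion>\<^sub>s t | b t. b \<in> insert {} (bdry s) \<and> t = {}}"
  proof (rule eq_dunion_familyI)
    fix v :: "('a \<times> 'k) set" assume "v \<in> insert {} (bdry (s \<squnion>\<^sub>s {}))"
    then have "v \<subseteq> s \<squnion>\<^sub>s {}" by (auto simp: bdry_def)
    then show "\<exists>b t. v = b \<squnion>\<^sub>s t" by (metis subset_dunionE)
  next
    show "b \<squnion>\<^sub>s t \<in> insert {} (bdry (s \<squnion>\<^sub>s {} :: ('a \<times> 'k) set))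
        \<longleftrightarrow> b \<in> insert {} (bdry s) \<and> t = {}" for b t
      by (auto simp: bdry_def)
  qed
  then show ?thesis by simp
qed

text \<open>As \<open>s\<close> is nonempty, the empty set does not contain \<open>s\<close> and so
  joins the old faces; in the cone part it restores what the definition removes.\<close>

lemma insert_empty_stellar:
  assumes "s \<noteq> {}"
  shows "insert {} (stellar K s x) = {t \<in> insert {} K. \<not> s \<subseteq> t} \<union>
     {a \<union> b \<union> c | a b c. a \<in> insert {} (link K s) \<and> b \<in> insert {} (bdry s) \<and> c \<in> {{}, {x}}}"
    (is "_ = ?A \<union> ?C")
proof -
  have "insert {} (A \<union> (C - {{}})) = insert {} A \<union> C" if "{} \<in> C" for A C :: "'a set set"
    using that by blast
  moreover have "{} \<in> ?C" by blast
  moreover have "?A = insert {} {t \<in> K. \<not> s \<subseteq> t}" using assms by auto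
  ultimately show ?thesis
    unfolding stellar_def Un_insert_right Un_empty_right by simp
qed

theorem proposition3p5:
  fixes K L :: "'a set set" and s :: "'a set" and x :: 'a
  assumes "abstract_complex K" and "abstract_complex L"
    and "s \<in> K" and "x \<notin> vertices K"
  shows "(stellar K s x \<star> L :: ('a \<times> 'k::semiring_1) set set)
           = stellar (K \<star> L) (s \<squnion>\<^sub>s {}) (x, 0)"
proof -
  let ?J = "K \<star> L :: ('a \<times> 'k) set set" and ?s = "s \<squnion>\<^sub>s {} :: ('a \<times> 'k) set"
  let ?C = "{a \<union> b \<union> c | a b c. a \<in> insert {} (link K s) \<and> b \<in> insert {} (bdry s) \<and> c \<in> {{}, {x}}}"
  have s: "s \<noteq> {}" using abstract_complexD(2)[OF assms(1,3)] .
  have cone: "{a \<union> b \<union> c | a b c. a \<in> insert {} (link ?J ?s) \<and> b \<in> insert {} (bdry ?s) \<and> c \<in> {{}, {(x, 0)}}}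
      = {u \<squnion>\<^sub>s t | u t. u \<in> ?C \<and> t \<in> insert {} L}"
  proof -
    \<comment> \<open>The new barycenter lies in the first copy: its singleton is
      \<open>{x} \<squnion>\<^sub>s {}\<close>.\<close>
    have "{{}, {(x, 0 :: 'k)}} = {c \<squnion>\<^sub>s {} | c. c \<in> {{}, {x}}}"
      by (auto simp: dunion_def)
    then show ?thesis
      unfolding insert_empty_link_cjoin[OF assms(3) s] insert_empty_bdry_dunion
      by (simp only: Un_dunion_families)
  qed
  have old: "{v \<in> insert {} ?J. \<not> ?s \<subseteq> v}
      = {u \<squnion>\<^sub>s t | u t. u \<in> {u \<in> insert {} K. \<not> s \<subseteq> u} \<and> t \<in> insert {} L}"
  proof -
    have "?s \<subseteq> u \<squnion>\<^sub>s t \<longleftrightarrow> s \<subseteq> u" for u t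
      by simp
    then show ?thesis
      unfolding insert_empty_cjoin by (intro set_eqI, unfold mem_Collect_eq) metis
  qed
  have "insert {} (stellar K s x \<star> L)
      = {u \<squnion>\<^sub>s t | u t. u \<in> {u \<in> insert {} K. \<not> s \<subseteq> u} \<union> ?C \<and> t \<in> insert {} L}"
    unfolding insert_empty_cjoin insert_empty_stellar[OF s] ..
  also have "\<dots> = {v \<in> insert {} ?J. \<not> ?s \<subseteq> v} \<union> {a \<union> b \<union> c | a b c.
      a \<in> insert {} (link ?J ?s) \<and> b \<in> insert {} (bdry ?s) \<and> c \<in> {{}, {(x, 0)}}}"
    \<comment> \<open>The join distributes over a union in its first factor, which separates old
      faces from cone faces.\<close>
    unfolding old cone Un_iff conj_disj_distribR ex_disj_distrib conj_disj_distribL Collect_disj_eq ..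
  also have "\<dots> = insert {} (stellar ?J ?s (x, 0))"
    by (rule insert_empty_stellar[symmetric]) (simp add: s)
  finally have eq: "insert {} (stellar K s x \<star> L) = insert {} (stellar ?J ?s (x, 0))" .
  \<comment> \<open>Neither side has the empty face, so the added one can be cancelled.\<close>
  have "{} \<notin> stellar K s x \<star> L" "{} \<notin> stellar ?J ?s (x, 0)"
    by (simp_all add: stellar_def cjoin_def)
  then show ?thesis
    by (rule insert_ident[THEN iffD1, OF _ _ eq])
qed

end
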